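(* Let $F$ be the free monoid on $\pi_1,\pi_2$, let $T$ be the monoid of $F$-colored binary trees, and let $U=T/\!\sim_{cp}$. Let $A\in U$ be represented by $\tilde A\in T$. Then $A$ has a right inverse in $U$ (there is $B\in U$ with $AB=1$) if and only if the family of colors of the leaves of $\tilde A$ is left independent.
   Context: A CQP monoid $(M,\Sigma,\pi_1,\pi_2)$ is a monoid $M$ with elements $\pi_1,\pi_2\in M$ and a function $\Sigma:M^2\to M$ such that $\pi_1\Sigma(a,b)=a$, $\pi_2\Sigma(a,b)=b$, and $\Sigma(ac,bc)=\Sigma(a,b)c$ for all $a,b,c\in M$. A congruence on it is an equivalence relation $\sim$ such that $a\sim b$ and $c\sim d$ imply $ac\sim bd$ and $\Sigma(a,c)\sim\Sigma(b,d)$. The CQP monoid $T$: $T$ is the set of finite nonempty ordered binary trees (each non-leaf vertex has exactly one left child and one right child) whose leaves are colored by elements of $F$; equivalently, the free magma with basis $F$. $\Sigma(A,B)$ is the tree whose root has left subtree $A$ and right subtree $B$. Elements of $F$ are identified with the one-vertex trees, and each $A\in T$ is either in $F$ or uniquely $A=\Sigma(A_1,A_2)$. $F$ acts on $T$ from the left: $\pi_i$ sends $w\in F$ to the word $\pi_iw$, and sends $\Sigma(A_1,A_2)$ to $A_i$; a word acts by applying its symbols one at a time from right to left. The product $AB$ is the tree obtained from $A$ by replacing each leaf of color $w\in F$ by $wB$. With this product, identity $1\in F$, $\Sigma$, and $\pi_1,\pi_2\in F$, $T$ is a CQP monoid. $\sim_{cp}$ is the smallest congruence on $T$ such that $\Sigma(\pi_1,\pi_2)\sim_{cp}1$,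 and $U=T/\!\sim_{cp}$ with the induced monoid structure. A family $w_1,\dots,w_n$ of elements of a free monoid $G$ is left dependent if $w_i=xw_j$ for some $x\in G$ and some $i\ne j$ (so a family with a repeated element is left dependent), and left independent if it is not left dependent. The family of colors of the leaves of a tree is indexed by its leaves. *)

theory Defs
  imports Main
begin

section \<open>CQP monoids and their congruences\<close>

locale cqp_monoid =
  fixes sigma :: "'m::monoid_mult \<Rightarrow> 'm \<Rightarrow> 'm" and p1 p2 :: 'm
  assumes p1_sigma: "p1 * sigma a b = a"
    and p2_sigma: "p2 * sigma a b = b"
    and sigma_mult: "sigma (a * c) (b * c) = sigma a b * c"

definition cqp_congruence ::
    "('m::monoid_mult \<Rightarrow> 'm \<Rightarrow> 'm) \<Rightarrow> ('m \<Rightarrow> 'm \<Rightarrow> bool) \<Rightarrow> bool" where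
  "cqp_congruence sigma r \<longleftrightarrow> equivp r \<and>
     (\<forall>a b c d. r a b \<and> r c d \<longrightarrow> r (a * c) (b * d) \<and> r (sigma a c) (sigma b d))"


section \<open>The monoid of colored trees\<close>

datatype gen = Pi1 | Pi2

text \<open>The free monoid on the two generators: lists under concatenation.\<close>

type_synonym word = "gen list"

datatype tree = Leaf word | Node tree tree

fun act_gen :: "gen \<Rightarrow> tree \<Rightarrow> tree" where
  "act_gen g (Leaf w) = Leaf (g # w)"
| "act_gen Pi1 (Node A B) = A"
| "act_gen Pi2 (Node A B) = B"

definition act :: "word \<Rightarrow> tree \<Rightarrow> tree" where
  "act w A = foldr act_gen w A"

primrec tree_mult :: "tree \<Rightarrow> tree \<Rightarrow> tree" where
  "tree_mult (Leaf w) C = act w C"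
| "tree_mult (Node A B) C = Node (tree_mult A C) (tree_mult B C)"

lemma act_Leaf: "act w (Leaf v) = Leaf (w @ v)"
  by (induction w) (auto simp: act_def)

lemma act_gen_mult: "tree_mult (act_gen g A) C = act_gen g (tree_mult A C)"
  by (cases g; cases A) (auto simp: act_def)

lemma act_mult: "tree_mult (act w A) C = act w (tree_mult A C)"
  by (induction w) (auto simp: act_def act_gen_mult)

instantiation tree :: monoid_mult
begin

definition one_tree :: tree where
  "1 = Leaf []"

definition times_tree :: "tree \<Rightarrow> tree \<Rightarrow> tree" where
  "A * B = tree_mult A B"

instance
proof
  fix A B C :: tree
  show "A * B * C = A * (B * C)"
    by (induction A) (auto simp: times_tree_def act_mult)
  show "1 * A = A"
    by (simp add: times_tree_def one_tree_def act_def)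
  show "A * 1 = A"
    by (induction A) (auto simp: times_tree_def one_tree_def act_Leaf)
qed

end

interpretation tree: cqp_monoid Node "Leaf [Pi1]" "Leaf [Pi2]"
  by standard (auto simp: times_tree_def act_def)


section \<open>The quotient by surjective pairing\<close>

definition cp :: "tree \<Rightarrow> tree \<Rightarrow> bool" where
  "cp A B \<longleftrightarrow>
     (\<forall>r. cqp_congruence Node r \<and> r (Node (Leaf [Pi1]) (Leaf [Pi2])) 1 \<longrightarrow> r A B)"

lemma cp_least:
  "cqp_congruence Node r \<Longrightarrow> r (Node (Leaf [Pi1]) (Leaf [Pi2])) 1 \<Longrightarrow> cp A B \<Longrightarrow> r A B"
  by (auto simp only: cp_def)

lemma cpI:
  "(\<And>r. cqp_congruence Node r \<Longrightarrow> r (Node (Leaf [Pi1]) (Leaf [Pi2])) 1 \<Longrightarrow> r A B) \<Longrightarrow> cp A B"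
  unfolding cp_def by iprover

lemma cqp_congruence_cp: "cqp_congruence Node cp"
proof -
  have equiv: "equivp r" if "cqp_congruence Node r" for r
    using that unfolding cqp_congruence_def by iprover
  have mult: "r (a * c) (b * d)" and node: "r (Node a c) (Node b d)"
    if "cqp_congruence Node r" "r a b" "r c d" for r a b c d
    using that unfolding cqp_congruence_def by iprover+
  have "equivp cp"
  proof (rule equivpI)
    show "reflp cp"
      by (rule reflpI, rule cpI, rule equivp_reflp, rule equiv)
    show "symp cp"
      by (rule sympI, rule cpI, rule equivp_symp, rule equiv, assumption, rule cp_least)
    show "transp cp"
    proof (rule transpI, rule cpI)
      fix A B C r
      assume "cp A B" "cp B C" and r: "cqp_congruence Node r" "r (Node (Leaf [Pi1]) (Leaf [Pi2])) 1"
      then have "r A B" "r B C"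
        by (iprover intro: cp_least)+
      then show "r A C"
        by (rule equivp_transp[OF equiv[OF r(1)]])
    qed
  qed
  moreover have "cp (a * c) (b * d)" and "cp (Node a c) (Node b d)" if "cp a b" "cp c d" for a b c d
    using that by (iprover intro: cpI mult node cp_least)+
  ultimately show ?thesis
    unfolding cqp_congruence_def by iprover
qed

lemma cp_pairing: "cp (Node (Leaf [Pi1]) (Leaf [Pi2])) 1"
  by (simp add: cp_def)

quotient_type U = tree / cp
  using cqp_congruence_cp by (simp add: cqp_congruence_def)

instantiation U :: monoid_mult
begin

lift_definition one_U :: U is "1 :: tree" .

lift_definition times_U :: "U \<Rightarrow> U \<Rightarrow> U" is "(*) :: tree \<Rightarrow> tree \<Rightarrow> tree"
  using cqp_congruence_cp by (auto simp: cqp_congruence_def)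

instance
proof
  fix A B C :: U
  have refl: "cp X X" for X
    using cqp_congruence_cp by (simp add: cqp_congruence_def equivp_reflp)
  show "A * B * C = A * (B * C)"
    by transfer (simp add: mult.assoc refl)
  show "1 * A = A"
    by transfer (simp add: refl)
  show "A * 1 = A"
    by transfer (simp add: refl)
qed

end

lift_definition sigma_U :: "U \<Rightarrow> U \<Rightarrow> U" is Node
  using cqp_congruence_cp by (auto simp: cqp_congruence_def)

interpretation U: cqp_monoid sigma_U "abs_U (Leaf [Pi1])" "abs_U (Leaf [Pi2])"
proof
  have refl: "cp X X" for X
    using cqp_congruence_cp by (simp add: cqp_congruence_def equivp_reflp)
  fix A B C :: U
  show "abs_U (Leaf [Pi1]) * sigma_U A B = A"
    by transfer (simp add: tree.p1_sigma refl)
  show "abs_U (Leaf [Pi2]) * sigma_U A B = B"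
    by transfer (simp add: tree.p2_sigma refl)
  show "sigma_U (A * C) (B * C) = sigma_U A B * C"
    by transfer (simp add: tree.sigma_mult refl)
qed


section \<open>Leaf colors and left independence\<close>

text \<open>The family of leaf colors is listed from left to right, one entry per leaf.\<close>

primrec leaf_colors :: "tree \<Rightarrow> word list" where
  "leaf_colors (Leaf w) = [w]"
| "leaf_colors (Node A B) = leaf_colors A @ leaf_colors B"

definition left_dependent :: "'a list list \<Rightarrow> bool" where
  "left_dependent ws \<longleftrightarrow>
     (\<exists>i<length ws. \<exists>j<length ws. i \<noteq> j \<and> (\<exists>x. ws ! i = x @ ws ! j))"

definition left_independent :: "'a list list \<Rightarrow> bool" where
  "left_independent ws \<longleftrightarrow> \<not> left_dependent ws"

end

theory Submission
  imports Defs "HOL-Library.Sublist"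
begin

text \<open>
  Give every leaf of a tree \<open>A\<close> its address: the word that extracts this leaf from \<open>A\<close>, with the
  step taken at the root as its last letter. Recoloring all leaves of \<open>A\<close> by their addresses yields
  a tree congruent to \<open>1\<close>, because each such tree collapses to \<open>1\<close> by repeated use of
  \<open>\<Sigma>(\<pi>\<^sub>1 p, \<pi>\<^sub>2 p) \<sim> p\<close>. Write \<open>w\<^sub>i\<close> for the colors of the leaves of \<open>A\<close> and \<open>p\<^sub>i\<close> for their addresses.

  If the colors are left independent, they are addresses of pairwise disjoint places in a binary
  tree, so there is a tree \<open>B\<close> that carries the prescribed leaf \<open>p\<^sub>i\<close> at the place \<open>w\<^sub>i\<close> for all \<open>i\<close> at
  once (\<open>prescribed_subtrees\<close>). Then \<open>A B\<close> is \<open>A\<close> recolored by its addresses, hence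
  congruent to \<open>1\<close>.

  Conversely let \<open>A B = 1\<close> in \<open>U\<close>. Multiplying \<open>p\<^sub>i A = w\<^sub>i\<close> by \<open>B\<close> gives \<open>p\<^sub>i = w\<^sub>i B\<close>, so a relation
  \<open>w\<^sub>i = x w\<^sub>j\<close> forces \<open>p\<^sub>i = x p\<^sub>j\<close> in \<open>U\<close>. Words embed in \<open>U\<close> (\<open>cp_Leaf_iff\<close>), so this relation
  already holds in the free monoid. For \<open>i \<noteq> j\<close> it is impossible, since addresses of different
  leaves are left independent.

  Words are separated in \<open>U\<close> by an explicit congruence: two trees are related if all sufficiently
  long words act on them with the same result.
\<close>

section \<open>Left independence as incomparability of suffixes\<close>

text \<open>
  Left dependence is the failure of being an antichain for the suffix order. In the form of
  \<^const>\<open>sorted_wrt\<close> it decomposes along \<open>#\<close> and \<open>@\<close>, as the inductions below require.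
\<close>

lemma left_independent_iff_sorted_wrt:
  "left_independent ws \<longleftrightarrow> sorted_wrt (\<lambda>v w. \<not> suffix v w \<and> \<not> suffix w v) ws"
proof -
  have "left_dependent ws \<longleftrightarrow>
    (\<exists>i<length ws. \<exists>j<length ws. i \<noteq> j \<and> suffix (ws ! j) (ws ! i))"
    by (auto simp: left_dependent_def suffix_def)
  then show ?thesis
    unfolding left_independent_def sorted_wrt_iff_nth_less
    by (metis nat_neq_iff order_less_trans)
qed


section \<open>Words acting on trees\<close>

lemma act_Nil [simp]: "act [] A = A"
  by (simp add: act_def)

lemma act_Cons: "act (g # w) A = act_gen g (act w A)"
  by (simp add: act_def)

lemma act_append: "act (v @ w) A = act v (act w A)"
  by (simp add: act_def)

lemma Leaf_mult: "Leaf w * A = act w A"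
  by (simp add: times_tree_def)

lemma act_times: "act w (A * B) = act w A * B"
  by (simp add: times_tree_def act_mult)

text \<open>
  A word longer than the height of a tree reaches a leaf, and the rest of it is added to the color.
  This is what makes the congruence \<open>eventually_same_action\<close> compatible with products.
\<close>

lemma act_long_word_is_long_Leaf:
  "\<exists>m. \<forall>w. m \<le> length w \<longrightarrow> (\<exists>v. act w A = Leaf v \<and> n \<le> length v)"
proof (induction A)
  case (Leaf u)
  then show ?case
    by (auto simp: act_Leaf intro!: exI[of _ n])
next
  case (Node A B)
  then obtain a b
    where a: "\<And>w. a \<le> length w \<Longrightarrow> \<exists>v. act w A = Leaf v \<and> n \<le> length v"
      and b: "\<And>w. b \<le> length w \<Longrightarrow> \<exists>v. act w B = Leaf v \<and> n \<le> length v"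
    by blast
  have "\<exists>v. act w (Node A B) = Leaf v \<and> n \<le> length v" if "Suc (a + b) \<le> length w" for w
  proof -
    from that obtain u g where w: "w = u @ [g]"
      by (cases w rule: rev_cases) auto
    with that a[of u] b[of u] show ?thesis
      by (cases g) (auto simp: act_append act_Cons)
  qed
  then show ?case
    by blast
qed


section \<open>The embedding of words in the quotient\<close>

definition eventually_same_action :: "tree \<Rightarrow> tree \<Rightarrow> bool" where
  "eventually_same_action A B \<longleftrightarrow> (\<exists>n. \<forall>w. n \<le> length w \<longrightarrow> act w A = act w B)"

lemma equivp_eventually_same_action: "equivp eventually_same_action"
proof (rule equivpI)
  show "reflp eventually_same_action"
    by (auto intro: reflpI simp: eventually_same_action_def)
  show "symp eventually_same_action"
    by (rule sympI) (metis eventually_same_action_def)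
  show "transp eventually_same_action"
  proof (rule transpI)
    fix A B C
    assume "eventually_same_action A B" "eventually_same_action B C"
    then obtain m n where "\<And>w. m \<le> length w \<Longrightarrow> act w A = act w B"
      "\<And>w. n \<le> length w \<Longrightarrow> act w B = act w C"
      unfolding eventually_same_action_def by blast
    then have "\<forall>w. max m n \<le> length w \<longrightarrow> act w A = act w C"
      by simp
    then show "eventually_same_action A C"
      unfolding eventually_same_action_def by blast
  qed
qed

lemma eventually_same_action_times:
  assumes "eventually_same_action A B" "eventually_same_action C D"
  shows "eventually_same_action (A * C) (B * D)"
proof -
  from assms obtain m n where m: "\<And>w. m \<le> length w \<Longrightarrow> act w A = act w B"
    and n: "\<And>w. n \<le> length w \<Longrightarrow> act w C = act w D"
    unfolding eventually_same_action_def by blast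
  obtain k where k: "\<And>w. k \<le> length w \<Longrightarrow> \<exists>v. act w B = Leaf v \<and> n \<le> length v"
    using act_long_word_is_long_Leaf[where A = B and n = n] by blast
  have "act w (A * C) = act w (B * D)" if "max m k \<le> length w" for w
    using that m[of w] n k[of w] by (auto simp: act_times Leaf_mult)
  then show ?thesis
    unfolding eventually_same_action_def by blast
qed

lemma eventually_same_action_Node:
  assumes "eventually_same_action A B" "eventually_same_action C D"
  shows "eventually_same_action (Node A C) (Node B D)"
proof -
  from assms obtain m n where m: "\<And>w. m \<le> length w \<Longrightarrow> act w A = act w B"
    and n: "\<And>w. n \<le> length w \<Longrightarrow> act w C = act w D"
    unfolding eventually_same_action_def by blast
  have "act w (Node A C) = act w (Node B D)" if "Suc (max m n) \<le> length w" for w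
  proof -
    from that obtain u g where "w = u @ [g]"
      by (cases w rule: rev_cases) auto
    with that m[of u] n[of u] show ?thesis
      by (cases g) (auto simp: act_append act_Cons)
  qed
  then show ?thesis
    unfolding eventually_same_action_def by blast
qed

lemma cqp_congruence_eventually_same_action: "cqp_congruence Node eventually_same_action"
  using equivp_eventually_same_action eventually_same_action_times eventually_same_action_Node
  by (simp add: cqp_congruence_def)

lemma eventually_same_action_pairing:
  "eventually_same_action (Node (Leaf [Pi1]) (Leaf [Pi2])) 1"
proof -
  have "act w (Node (Leaf [Pi1]) (Leaf [Pi2])) = act w 1" if "1 \<le> length w" for w
  proof -
    from that obtain u g where "w = u @ [g]"
      by (cases w rule: rev_cases) auto
    then show ?thesis
      by (cases g) (auto simp: act_append act_Cons one_tree_def)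
  qed
  then show ?thesis
    unfolding eventually_same_action_def by blast
qed

lemma cp_refl: "cp A A"
  using cqp_congruence_cp by (simp add: cqp_congruence_def equivp_reflp)

text \<open>
  A word \<open>w\<close> acts on the one-vertex trees \<open>u\<close> and \<open>v\<close> by prepending itself, so
  \<^const>\<open>eventually_same_action\<close> separates distinct words by cancellation.
\<close>

lemma cp_Leaf_iff: "cp (Leaf u) (Leaf v) \<longleftrightarrow> u = v"
proof
  assume "cp (Leaf u) (Leaf v)"
  then have "eventually_same_action (Leaf u) (Leaf v)"
    by (rule cp_least[OF cqp_congruence_eventually_same_action eventually_same_action_pairing])
  then obtain n where "act w (Leaf u) = act w (Leaf v)" if "n \<le> length w" for w
    unfolding eventually_same_action_def by blast
  from this[of "replicate n Pi1"] show "u = v"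
    by (simp add: act_Leaf)
qed (simp add: cp_refl)


section \<open>Recoloring leaves by their addresses\<close>

text \<open>
  The word \<open>p\<close> is the address of the root, which varies when the tree is a subtree of a larger one.
\<close>

primrec addressed :: "tree \<Rightarrow> word \<Rightarrow> tree" where
  "addressed (Leaf w) p = Leaf p"
| "addressed (Node A B) p = Node (addressed A (Pi1 # p)) (addressed B (Pi2 # p))"

abbreviation leaf_addresses :: "tree \<Rightarrow> word \<Rightarrow> word list" where
  "leaf_addresses A p \<equiv> leaf_colors (addressed A p)"

lemma length_leaf_addresses: "length (leaf_addresses A p) = length (leaf_colors A)"
  by (induction A arbitrary: p) auto

text \<open>Multiplying the pairing relation on the right by a word \<open>p\<close> gives \<open>\<Sigma>(\<pi>\<^sub>1 p, \<pi>\<^sub>2 p) \<sim> p\<close>.\<close>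

lemma cp_addressed: "cp (addressed A p) (Leaf p)"
proof (induction A arbitrary: p)
  case (Leaf w)
  then show ?case
    by (simp add: cp_refl)
next
  case (Node A B)
  have "cp (Node (Leaf [Pi1]) (Leaf [Pi2]) * Leaf p) (1 * Leaf p)"
    using cqp_congruence_cp cp_pairing cp_refl unfolding cqp_congruence_def by blast
  then have "cp (Node (Leaf (Pi1 # p)) (Leaf (Pi2 # p))) (Leaf p)"
    by (simp add: times_tree_def one_tree_def act_def)
  moreover have "cp (addressed (Node A B) p) (Node (Leaf (Pi1 # p)) (Leaf (Pi2 # p)))"
    using cqp_congruence_cp Node by (auto simp: cqp_congruence_def)
  moreover have "equivp cp"
    using cqp_congruence_cp by (simp add: cqp_congruence_def)
  ultimately show ?case
    by (blast intro: equivp_transp)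
qed

lemma suffix_leaf_addresses: "q \<in> set (leaf_addresses A p) \<Longrightarrow> suffix p q"
  by (induction A arbitrary: p) (auto dest: suffix_ConsD)

text \<open>
  Leaves in different halves of a tree have addresses that end in \<open>Pi1 # p\<close> and in \<open>Pi2 # p\<close>. These
  endings have equal length and differ, so neither address is a suffix of the other.
\<close>

lemma left_independent_leaf_addresses: "left_independent (leaf_addresses A p)"
  unfolding left_independent_iff_sorted_wrt
proof (induction A arbitrary: p)
  case (Node A B)
  have "\<not> suffix u v \<and> \<not> suffix v u" if "suffix (Pi1 # p) u" "suffix (Pi2 # p) v" for u v
  proof -
    have "\<not> (suffix (Pi1 # p) z \<and> suffix (Pi2 # p) z)" for z
      by (auto simp: suffix_def)
    with that show ?thesis
      by (meson suffix_order.order_trans)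
  qed
  then have "\<forall>u \<in> set (leaf_addresses A (Pi1 # p)). \<forall>v \<in> set (leaf_addresses B (Pi2 # p)).
      \<not> suffix u v \<and> \<not> suffix v u"
    by (meson suffix_leaf_addresses)
  with Node show ?case
    by (simp add: sorted_wrt_append)
qed simp

text \<open>
  The induction descends into a subtree \<open>A\<close> of a fixed tree \<open>C\<close>, keeping the address \<open>p\<close> of \<open>A\<close>.
\<close>

lemma act_leaf_addresses:
  assumes "act p C = A"
  shows "list_all2 (\<lambda>q w. act q C = Leaf w) (leaf_addresses A p) (leaf_colors A)"
  using assms
proof (induction A arbitrary: p)
  case (Node A B)
  have "act (Pi1 # p) C = A" "act (Pi2 # p) C = B"
    using Node.prems by (simp_all add: act_Cons)
  with Node.IH show ?case
    by (simp add: list_all2_appendI)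
qed simp

text \<open>
  Multiplication by \<open>B\<close> keeps the shape of \<open>A\<close> and changes each color \<open>w\<close> to \<open>w B\<close>, so it suffices
  that \<open>B\<close> sends each color to the address of its leaf.
\<close>

lemma mult_eq_addressed:
  assumes "list_all2 (\<lambda>w q. act w B = Leaf q) (leaf_colors A) (leaf_addresses A p)"
  shows "A * B = addressed A p"
  using assms
  by (induction A arbitrary: p)
    (auto simp: times_tree_def list_all2_append length_leaf_addresses)


section \<open>Trees with prescribed subtrees at independent places\<close>

text \<open>
  Replaces the subtree at a place by \<open>t\<close>. The place is read from the root, so it is the reversal of
  the word that extracts the subtree. Taking the halves of \<open>B\<close> by \<^const>\<open>act_gen\<close> splits a leaf \<open>w\<close>
  into \<open>\<Sigma>(\<pi>\<^sub>1 w, \<pi>\<^sub>2 w)\<close> when the place lies below it.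
\<close>

fun replace_at :: "gen list \<Rightarrow> tree \<Rightarrow> tree \<Rightarrow> tree" where
  "replace_at [] t B = t"
| "replace_at (Pi1 # r) t B = Node (replace_at r t (act_gen Pi1 B)) (act_gen Pi2 B)"
| "replace_at (Pi2 # r) t B = Node (act_gen Pi1 B) (replace_at r t (act_gen Pi2 B))"

lemma act_replace_at_same: "act (rev r) (replace_at r t B) = t"
  by (induction r t B rule: replace_at.induct) (auto simp: act_append act_Cons)

lemma act_replace_at_other:
  assumes "\<not> prefix r s" "\<not> prefix s r"
  shows "act (rev s) (replace_at r t B) = act (rev s) B"
  using assms
proof (induction r t B arbitrary: s rule: replace_at.induct)
  case (2 r t B)
  then obtain g s' where "s = g # s'"
    by (cases s) auto
  with 2 show ?case
    by (cases g) (auto simp: act_append act_Cons)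
next
  case (3 r t B)
  then obtain g s' where "s = g # s'"
    by (cases s) auto
  with 3 show ?case
    by (cases g) (auto simp: act_append act_Cons)
qed simp

text \<open>
  The subtrees are put in one after another; by independence, no replacement disturbs the others.
\<close>

lemma prescribed_subtrees:
  assumes "left_independent ws" "length ws = length ts"
  shows "\<exists>B. list_all2 (\<lambda>w t. act w B = t) ws ts"
  using assms(2,1) unfolding left_independent_iff_sorted_wrt
proof (induction ws ts rule: list_induct2)
  case (Cons w ws t ts)
  then obtain B where B: "list_all2 (\<lambda>w t. act w B = t) ws ts"
    by auto
  let ?B = "replace_at (rev w) t B"
  have "act w ?B = t"
    using act_replace_at_same[of "rev w"] by simp
  moreover have "act v ?B = act v B" if "v \<in> set ws" for v
    using act_replace_at_other[of "rev w" "rev v"] Cons.prems that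
    by (auto simp: suffix_to_prefix)
  then have "list_all2 (\<lambda>w t. act w ?B = t) ws ts"
    using B by (auto simp: list_all2_conv_all_nth)
  ultimately show ?case
    by auto
qed simp


section \<open>Right invertible elements of the quotient\<close>

lemma right_inverse_if_left_independent:
  assumes "left_independent (leaf_colors A)"
  shows "\<exists>B. abs_U A * B = 1"
proof -
  obtain B where "list_all2 (\<lambda>w t. act w B = t) (leaf_colors A) (map Leaf (leaf_addresses A []))"
    using prescribed_subtrees[OF assms, of "map Leaf (leaf_addresses A [])"]
    by (auto simp: length_leaf_addresses)
  then have "A * B = addressed A []"
    by (intro mult_eq_addressed) (simp add: list.rel_map)
  then have "cp (A * B) 1"
    using cp_addressed[of A "[]"] by (simp add: one_tree_def)
  then have "abs_U A * abs_U B = 1"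
    by (simp add: times_U.abs_eq one_U_def U.abs_eq_iff)
  then show ?thesis ..
qed

lemma left_independent_if_right_inverse:
  assumes inverse: "abs_U A * B = 1"
  shows "left_independent (leaf_colors A)"
proof (rule ccontr)
  let ?ws = "leaf_colors A" and ?ps = "leaf_addresses A []"
  assume "\<not> left_independent ?ws"
  then obtain i j x where ij: "i < length ?ws" "j < length ?ws" "i \<noteq> j"
    and x: "?ws ! i = x @ ?ws ! j"
    by (auto simp: left_independent_def left_dependent_def)
  have address_eq: "abs_U (Leaf (?ps ! k)) = abs_U (Leaf (?ws ! k)) * B" if "k < length ?ws" for k
  proof -
    have "act (?ps ! k) A = Leaf (?ws ! k)"
      using act_leaf_addresses[of "[]" A A] that
      by (auto simp: list_all2_conv_all_nth length_leaf_addresses)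
    then have "abs_U (Leaf (?ps ! k)) * abs_U A = abs_U (Leaf (?ws ! k))"
      by (simp add: times_U.abs_eq Leaf_mult)
    then show ?thesis
      using inverse by (metis mult.assoc mult.right_neutral)
  qed
  have word_mult: "abs_U (Leaf (u @ v)) = abs_U (Leaf u) * abs_U (Leaf v)" for u v
    by (simp add: times_U.abs_eq Leaf_mult act_Leaf)
  have "abs_U (Leaf (?ps ! i)) = abs_U (Leaf (x @ ?ps ! j))"
    by (simp add: address_eq ij x word_mult mult.assoc)
  then have "?ps ! i = x @ ?ps ! j"
    by (simp add: U.abs_eq_iff cp_Leaf_iff)
  with ij have "left_dependent ?ps"
    by (auto simp: left_dependent_def length_leaf_addresses)
  with left_independent_leaf_addresses show False
    by (auto simp: left_independent_def)
qed

theorem theorem4: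
  fixes A :: U and A' :: tree
  assumes "A = abs_U A'"
  shows "(\<exists>B :: U. A * B = 1) \<longleftrightarrow> left_independent (leaf_colors A')"
  using assms right_inverse_if_left_independent left_independent_if_right_inverse by blast

end
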